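(* Suppose that a general source $\mathbf{V}=\{V^n\}_{n=1}^\infty$ is transmissible over a general channel $\mathbf{W}=\{W^n\}_{n=1}^\infty$. Then there is some channel input $\mathbf{X}=\{X^n\}_{n=1}^\infty$, which may be arbitrarily correlated to the output of the source $\mathbf{V}$, such that for any sequence $\{\gamma_n\}_{n=1}^\infty$ of real numbers satisfying $$\gamma_n>0,\quad \gamma_n\to0\quad\text{and}\quad n\gamma_n\to\infty\qquad(n\to\infty)$$ it holds that $$\lim_{n\to\infty}\Pr\left\{\frac1n\log\frac{W^n(Y^n|X^n)}{P_{Y^n}(Y^n)}\le\frac1n\log\frac1{P_{V^n}(V^n)}-\gamma_n\right\}=0,$$ where $Y^n$ is the channel output via $W^n$ due to the channel input $X^n$.
   Context: A general source $\mathbf{V}=\{V^n\}_{n=1}^\infty$ is an arbitrary sequence of random variables $V^n=(V_1^{(n)},\dots,V_n^{(n)})$ with values in $\mathcal{V}^n$, where the source alphabet $\mathcal{V}$ is a countably infinite set; no consistency between different $n$ is required. A general channel $\mathbf{W}=\{W^n(\cdot|\cdot):\mathcal{X}^n\to\mathcal{Y}^n\}_{n=1}^\infty$ is an arbitrary sequence of transition probabilities (Markov kernels) $W^n$ from $\mathcal{X}^n$ to $\mathcal{Y}^n$, where $\mathcal{X},\mathcal{Y}$ are arbitrary abstract (measurable) alphabets. $P_Z$ denotes the distribution of $Z$. Logarithms are natural. A channel input $\mathbf{X}=\{X^n\}$ is a sequence of random variables $X^n$ with values in $\mathcal{X}^n$. "$Y^n$ is the channel output via $W^n$ due to the input $X^n$"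 means that the conditional distribution of $Y^n$ given $X^n=\mathbf{x}$ is $W^n(\cdot|\mathbf{x})$ and $V^n\to X^n\to Y^n$ is a Markov chain. For abstract alphabets, $\frac{W^n(Y^n|X^n)}{P_{Y^n}(Y^n)}$ means $g(Y^n|X^n)$, where $g(\mathbf{y}|\mathbf{x})=\frac{W^n(d\mathbf{y}|\mathbf{x})}{P_{Y^n}(d\mathbf{y})}=\frac{P_{X^nY^n}(d\mathbf{x},d\mathbf{y})}{P_{X^n}(d\mathbf{x})P_{Y^n}(d\mathbf{y})}$ is the Radon-Nikodym derivative, measurable in $(\mathbf{x},\mathbf{y})$. A joint source-channel $(n,\varepsilon_n)$ code is a pair of an encoder $\varphi_n:\mathcal{V}^n\to\mathcal{X}^n$ and a decoder $\psi_n:\mathcal{Y}^n\to\mathcal{V}^n$ (deterministic maps) whose probability of decoding error is $\varepsilon_n=\sum_{\mathbf{v}\in\mathcal{V}^n}P_{V^n}(\mathbf{v})\,W^n(\mathcal{D}^c(\mathbf{v})|\varphi_n(\mathbf{v}))$, where $\mathcal{D}(\mathbf{v})=\{\mathbf{y}\in\mathcal{Y}^n:\psi_n(\mathbf{y})=\mathbf{v}\}$. The source $\mathbf{V}$ is transmissible over the channel $\mathbf{W}$ if there exists a sequence of $(n,\varepsilon_n)$ codes with $\lim_{n\to\infty}\varepsilon_n=0$. *)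

theory Defs
  imports "HOL-Probability.Probability"
begin

text \<open>
  Random variables enter only through their laws.  A block of length \<open>n\<close> is an (extensional)
  function on \<open>{..<n}\<close>.  The source alphabet \<open>A\<close> is discrete, so all subsets of the set of source
  blocks are measurable; the channel alphabets are arbitrary measurable spaces.  Sequences are
  indexed by \<open>n \<ge> 1\<close>; their values at \<open>0\<close> are irrelevant.
\<close>

definition source_space :: "'v set \<Rightarrow> nat \<Rightarrow> (nat \<Rightarrow> 'v) measure" where
  "source_space A n = count_space ({..<n} \<rightarrow>\<^sub>E A)"

definition block_space :: "'a measure \<Rightarrow> nat \<Rightarrow> (nat \<Rightarrow> 'a) measure" where
  "block_space M n = (\<Pi>\<^sub>M i\<in>{..<n}. M)"

definition general_source :: "'v set \<Rightarrow> (nat \<Rightarrow> (nat \<Rightarrow> 'v) measure) \<Rightarrow> bool" where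
  "general_source A P \<longleftrightarrow> (\<forall>n\<ge>1. P n \<in> space (prob_algebra (source_space A n)))"

definition general_channel ::
  "'x measure \<Rightarrow> 'y measure \<Rightarrow> (nat \<Rightarrow> (nat \<Rightarrow> 'x) \<Rightarrow> (nat \<Rightarrow> 'y) measure) \<Rightarrow> bool" where
  "general_channel MX MY W \<longleftrightarrow>
     (\<forall>n\<ge>1. W n \<in> block_space MX n \<rightarrow>\<^sub>M prob_algebra (block_space MY n))"

text \<open>
  The decoder is required to be measurable, i.e. its decoding regions are events, as is implicit
  in the definition of the error probability.
\<close>

definition joint_code ::
  "'v set \<Rightarrow> 'x measure \<Rightarrow> 'y measure \<Rightarrow> nat \<Rightarrow>
   ((nat \<Rightarrow> 'v) \<Rightarrow> (nat \<Rightarrow> 'x)) \<Rightarrow> ((nat \<Rightarrow> 'y) \<Rightarrow> (nat \<Rightarrow> 'v)) \<Rightarrow> bool" where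
  "joint_code A MX MY n \<phi> \<psi> \<longleftrightarrow>
     \<phi> \<in> space (source_space A n) \<rightarrow> space (block_space MX n) \<and>
     \<psi> \<in> block_space MY n \<rightarrow>\<^sub>M source_space A n"

definition decoding_region ::
  "'y measure \<Rightarrow> nat \<Rightarrow> ((nat \<Rightarrow> 'y) \<Rightarrow> (nat \<Rightarrow> 'v)) \<Rightarrow> (nat \<Rightarrow> 'v) \<Rightarrow> (nat \<Rightarrow> 'y) set" where
  "decoding_region MY n \<psi> v = {y \<in> space (block_space MY n). \<psi> y = v}"

definition error_prob ::
  "'v set \<Rightarrow> 'y measure \<Rightarrow> nat \<Rightarrow> (nat \<Rightarrow> 'v) measure \<Rightarrow> ((nat \<Rightarrow> 'x) \<Rightarrow> (nat \<Rightarrow> 'y) measure) \<Rightarrow>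
   ((nat \<Rightarrow> 'v) \<Rightarrow> (nat \<Rightarrow> 'x)) \<Rightarrow> ((nat \<Rightarrow> 'y) \<Rightarrow> (nat \<Rightarrow> 'v)) \<Rightarrow> real" where
  "error_prob A MY n Pn Wn \<phi> \<psi> =
     (\<Sum>\<^sub>\<infinity>v\<in>space (source_space A n).
        measure Pn {v} *
        measure (Wn (\<phi> v)) (space (block_space MY n) - decoding_region MY n \<psi> v))"

definition transmissible ::
  "'v set \<Rightarrow> 'x measure \<Rightarrow> 'y measure \<Rightarrow> (nat \<Rightarrow> (nat \<Rightarrow> 'v) measure) \<Rightarrow>
   (nat \<Rightarrow> (nat \<Rightarrow> 'x) \<Rightarrow> (nat \<Rightarrow> 'y) measure) \<Rightarrow> bool" where
  "transmissible A MX MY P W \<longleftrightarrow>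
     (\<exists>\<phi> \<psi>. (\<forall>n\<ge>1. joint_code A MX MY n (\<phi> n) (\<psi> n)) \<and>
        (\<lambda>n. error_prob A MY n (P n) (W n) (\<phi> n) (\<psi> n)) \<longlonglongrightarrow> 0)"

text \<open>
  A channel input is given by the joint laws \<open>Q n\<close> of source block and input block; any
  correlation with the source is allowed, only the source marginal is prescribed.
\<close>

definition channel_input ::
  "'v set \<Rightarrow> 'x measure \<Rightarrow> (nat \<Rightarrow> (nat \<Rightarrow> 'v) measure) \<Rightarrow>
   (nat \<Rightarrow> ((nat \<Rightarrow> 'v) \<times> (nat \<Rightarrow> 'x)) measure) \<Rightarrow> bool" where
  "channel_input A MX P Q \<longleftrightarrow>
     (\<forall>n\<ge>1. Q n \<in> space (prob_algebra (source_space A n \<Otimes>\<^sub>M block_space MX n)) \<and>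
        distr (Q n) (source_space A n) fst = P n)"

text \<open>
  Joint law of source block, channel input and channel output.  The conditional law of the output
  given \<open>(v, x)\<close> is \<open>Wn x\<close>, so source, input and output form a Markov chain.
\<close>

definition joint_law ::
  "'v set \<Rightarrow> 'x measure \<Rightarrow> 'y measure \<Rightarrow> nat \<Rightarrow> ((nat \<Rightarrow> 'v) \<times> (nat \<Rightarrow> 'x)) measure \<Rightarrow>
   ((nat \<Rightarrow> 'x) \<Rightarrow> (nat \<Rightarrow> 'y) measure) \<Rightarrow>
   ((nat \<Rightarrow> 'v) \<times> (nat \<Rightarrow> 'x) \<times> (nat \<Rightarrow> 'y)) measure" where
  "joint_law A MX MY n Qn Wn =
     Qn \<bind> (\<lambda>(v, x). Wn x \<bind>
       (\<lambda>y. return (source_space A n \<Otimes>\<^sub>M block_space MX n \<Otimes>\<^sub>M block_space MY n) (v, x, y)))"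

definition input_law ::
  "'x measure \<Rightarrow> nat \<Rightarrow> ((nat \<Rightarrow> 'v) \<times> (nat \<Rightarrow> 'x) \<times> (nat \<Rightarrow> 'y)) measure \<Rightarrow> (nat \<Rightarrow> 'x) measure" where
  "input_law MX n J = distr J (block_space MX n) (\<lambda>(v, x, y). x)"

definition output_law ::
  "'y measure \<Rightarrow> nat \<Rightarrow> ((nat \<Rightarrow> 'v) \<times> (nat \<Rightarrow> 'x) \<times> (nat \<Rightarrow> 'y)) measure \<Rightarrow> (nat \<Rightarrow> 'y) measure" where
  "output_law MY n J = distr J (block_space MY n) (\<lambda>(v, x, y). y)"

definition input_output_law ::
  "'x measure \<Rightarrow> 'y measure \<Rightarrow> nat \<Rightarrow> ((nat \<Rightarrow> 'v) \<times> (nat \<Rightarrow> 'x) \<times> (nat \<Rightarrow> 'y)) measure \<Rightarrow>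
   ((nat \<Rightarrow> 'x) \<times> (nat \<Rightarrow> 'y)) measure" where
  "input_output_law MX MY n J =
     distr J (block_space MX n \<Otimes>\<^sub>M block_space MY n) (\<lambda>(v, x, y). (x, y))"

definition product_law ::
  "'x measure \<Rightarrow> 'y measure \<Rightarrow> nat \<Rightarrow> ((nat \<Rightarrow> 'v) \<times> (nat \<Rightarrow> 'x) \<times> (nat \<Rightarrow> 'y)) measure \<Rightarrow>
   ((nat \<Rightarrow> 'x) \<times> (nat \<Rightarrow> 'y)) measure" where
  "product_law MX MY n J = input_law MX n J \<Otimes>\<^sub>M output_law MY n J"

text \<open>
  Logarithm of the jointly measurable density of the input-output law with respect to the product
  of its marginals.  It is meaningful when the former is absolutely continuous with respect to the
  latter; then all versions of the density agree, and are positive and finite, almost surely under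
  the input-output law, so neither the choice made by \<open>RN_deriv\<close> nor the values of \<open>ln\<close> and
  \<open>enn2real\<close> at \<open>0\<close> and \<open>\<infinity>\<close> affect probabilities.
\<close>

definition information_density ::
  "'x measure \<Rightarrow> 'y measure \<Rightarrow> nat \<Rightarrow> ((nat \<Rightarrow> 'v) \<times> (nat \<Rightarrow> 'x) \<times> (nat \<Rightarrow> 'y)) measure \<Rightarrow>
   (nat \<Rightarrow> 'x) \<Rightarrow> (nat \<Rightarrow> 'y) \<Rightarrow> real" where
  "information_density MX MY n J x y =
     ln (enn2real (RN_deriv (product_law MX MY n J) (input_output_law MX MY n J) (x, y)))"

lemma joint_law_in_prob_algebra:
  assumes Q: "Qn \<in> space (prob_algebra (source_space A n \<Otimes>\<^sub>M block_space MX n))"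
    and W [measurable]: "Wn \<in> block_space MX n \<rightarrow>\<^sub>M prob_algebra (block_space MY n)"
  shows "joint_law A MX MY n Qn Wn \<in>
    space (prob_algebra (source_space A n \<Otimes>\<^sub>M block_space MX n \<Otimes>\<^sub>M block_space MY n))"
proof -
  have K: "(\<lambda>(v, x). Wn x \<bind>
       (\<lambda>y. return (source_space A n \<Otimes>\<^sub>M block_space MX n \<Otimes>\<^sub>M block_space MY n) (v, x, y)))
     \<in> source_space A n \<Otimes>\<^sub>M block_space MX n \<rightarrow>\<^sub>M
       prob_algebra (source_space A n \<Otimes>\<^sub>M block_space MX n \<Otimes>\<^sub>M block_space MY n)"
    by measurable
  show ?thesis
    using prob_space_bind'[OF Q K] sets_bind'[OF Q K]
    by (simp add: joint_law_def space_prob_algebra)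
qed

end

theory Submission
  imports Defs
begin

text \<open>
  Choose codes with vanishing error and take the codeword \<open>X = \<phi> V\<close> of the source block as the
  channel input.  Everything then follows from a bound at a fixed block length
  (\<open>low_information_prob_le_error\<close>): for every real \<open>c\<close>, the probability that the information
  density of input and output is at most \<open>ln (1 / p V) - c\<close>, where \<open>p\<close> is the source law, is at
  most \<open>\<epsilon> + exp (- c)\<close>, where \<open>\<epsilon>\<close> is the error probability of the code.
  Taking \<open>c = n * \<gamma> n\<close>, which tends to infinity, makes both terms on the right vanish.

  For the bound, split the event according to whether the decoder is right.  The part where it
  errs has probability at most \<open>\<epsilon>\<close>.  On the other part the output lies in the decoding region
  \<open>D v\<close> of the block \<open>v\<close> that was sent, while the density
  \<open>g\<close> of the joint law of input and output with respect to the product of its marginals is at most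
  \<open>exp (- c) / p v\<close>.  Integrating \<open>g\<close> against the output law, this has conditional probability at most
  \<open>exp (- c) / p v\<close> times the output probability of \<open>D v\<close> (\<open>low_information_bound\<close>).
  Averaging over \<open>v\<close> cancels the factor \<open>p v\<close>, and the decoding regions partition the output
  space, so the total is at most \<open>exp (- c)\<close>.

  The measure-theoretic point is that \<open>g (\<phi> v, _)\<close> must be the density of the channel law
  \<open>w (\<phi> v)\<close> for each individual block \<open>v\<close> of positive probability, although a Radon-Nikodym
  derivative is only determined almost everywhere and the input alphabet is arbitrary, so that
  single codewords need not be measurable sets.  Countability of the source resolves this: a
  property that holds almost everywhere under the law of \<open>\<phi> V\<close> holds at \<open>\<phi> v\<close> for every source
  block \<open>v\<close> of positive probability (\<open>channel_law_density\<close>).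
\<close>

section \<open>Measures on a countable discrete space\<close>

lemma density_count_space_emeasure:
  assumes "countable \<Omega>" "sets N = sets (count_space \<Omega>)"
  shows "density (count_space \<Omega>) (\<lambda>v. emeasure N {v}) = N"
  using assms by (intro density_discrete) auto

lemma nn_integral_countable_discrete:
  assumes "countable \<Omega>" "sets N = sets (count_space \<Omega>)"
  shows "(\<integral>\<^sup>+v. f v \<partial>N) = (\<integral>\<^sup>+v. emeasure N {v} * f v \<partial>count_space \<Omega>)"
  by (subst (1) density_count_space_emeasure[OF assms, symmetric]) (simp add: nn_integral_density)

lemma AE_countable_discrete:
  assumes "countable \<Omega>" "sets N = sets (count_space \<Omega>)"
  shows "(AE v in N. R v) \<longleftrightarrow> (\<forall>v\<in>\<Omega>. 0 < emeasure N {v} \<longrightarrow> R v)"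
  by (subst (1) density_count_space_emeasure[OF assms, symmetric])
     (simp add: AE_density AE_count_space)

section \<open>Laws induced by a code of fixed block length\<close>

locale source_channel_code =
  fixes A :: "'v set" and MX :: "'x measure" and MY :: "'y measure" and n :: nat
    and p :: "(nat \<Rightarrow> 'v) measure" and w :: "(nat \<Rightarrow> 'x) \<Rightarrow> (nat \<Rightarrow> 'y) measure"
    and \<phi> :: "(nat \<Rightarrow> 'v) \<Rightarrow> (nat \<Rightarrow> 'x)" and \<psi> :: "(nat \<Rightarrow> 'y) \<Rightarrow> (nat \<Rightarrow> 'v)"
  assumes countable_alphabet: "countable A"
    and source: "p \<in> space (prob_algebra (source_space A n))"
    and channel[measurable]: "w \<in> block_space MX n \<rightarrow>\<^sub>M prob_algebra (block_space MY n)"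
    and code: "joint_code A MX MY n \<phi> \<psi>"
begin

abbreviation "S \<equiv> source_space A n"
abbreviation "BX \<equiv> block_space MX n"
abbreviation "BY \<equiv> block_space MY n"

definition encoded_input :: "((nat \<Rightarrow> 'v) \<times> (nat \<Rightarrow> 'x)) measure" where
  "encoded_input = distr p (S \<Otimes>\<^sub>M BX) (\<lambda>v. (v, \<phi> v))"

abbreviation "J \<equiv> joint_law A MX MY n encoded_input w"
abbreviation "pX \<equiv> input_law MX n J"
abbreviation "pY \<equiv> output_law MY n J"
abbreviation "pXY \<equiv> input_output_law MX MY n J"
abbreviation "pX_pY \<equiv> product_law MX MY n J"
definition g :: "(nat \<Rightarrow> 'x) \<times> (nat \<Rightarrow> 'y) \<Rightarrow> ennreal" where
  "g = RN_deriv pX_pY pXY"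

sublocale source: prob_space p
  using source by (simp add: space_prob_algebra)

lemma sets_p[measurable_cong]: "sets p = sets S"
  using source by (simp add: space_prob_algebra)

lemma space_p: "space p = space S"
  using sets_p by (rule sets_eq_imp_space_eq)

lemma S_count_space: "S = count_space (space S)"
  by (simp add: source_space_def)

lemma countable_blocks: "countable (space S)"
  unfolding source_space_def using countable_alphabet by (auto intro: countable_PiE)

lemma singleton_in_sets: "v \<in> space S \<Longrightarrow> {v} \<in> sets S"
  by (simp add: source_space_def)

lemma sets_p_count_space: "sets p = sets (count_space (space S))"
  using sets_p S_count_space by simp

lemmas nn_integral_p = nn_integral_countable_discrete[OF countable_blocks sets_p_count_space]
lemmas AE_p = AE_countable_discrete[OF countable_blocks sets_p_count_space]

lemma measurable_p: "f \<in> p \<rightarrow>\<^sub>M N \<longleftrightarrow> f \<in> space S \<rightarrow> space N"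
  by (simp add: measurable_cong_sets[OF sets_p_count_space refl])

lemma measurable_encoder[measurable]: "\<phi> \<in> S \<rightarrow>\<^sub>M BX"
  using code unfolding joint_code_def by (subst S_count_space) auto

lemma measurable_decoder[measurable]: "\<psi> \<in> BY \<rightarrow>\<^sub>M S"
  using code unfolding joint_code_def by simp

lemma encoder_space: "v \<in> space S \<Longrightarrow> \<phi> v \<in> space BX"
  by (rule measurable_space[OF measurable_encoder])

lemma prob_space_w: "x \<in> space BX \<Longrightarrow> prob_space (w x)"
  and sets_w: "x \<in> space BX \<Longrightarrow> sets (w x) = sets BY"
  and space_w: "x \<in> space BX \<Longrightarrow> space (w x) = space BY"
  using measurable_space[OF channel] sets_eq_imp_space_eq[of "w x" BY]
  by (auto simp: space_prob_algebra)

lemma encoded_input_in_prob_algebra: "encoded_input \<in> space (prob_algebra (S \<Otimes>\<^sub>M BX))"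
  unfolding encoded_input_def space_prob_algebra by (auto intro!: source.prob_space_distr)

lemma source_marginal_encoded_input: "distr encoded_input S fst = p"
proof -
  have "distr encoded_input S fst = distr p S (\<lambda>v. v)"
    unfolding encoded_input_def by (subst distr_distr) (auto simp: comp_def)
  then show ?thesis
    using sets_p by (simp add: distr_id2)
qed

lemma J_in_prob_algebra: "J \<in> space (prob_algebra (S \<Otimes>\<^sub>M BX \<Otimes>\<^sub>M BY))"
  by (rule joint_law_in_prob_algebra[OF encoded_input_in_prob_algebra channel])

sublocale joint: prob_space J
  using J_in_prob_algebra by (simp add: space_prob_algebra)

lemma sets_J[measurable_cong]: "sets J = sets (S \<Otimes>\<^sub>M BX \<Otimes>\<^sub>M BY)"
  using J_in_prob_algebra by (simp add: space_prob_algebra)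

lemma J_eq_bind: "J = p \<bind> (\<lambda>v. distr (w (\<phi> v)) (S \<Otimes>\<^sub>M BX \<Otimes>\<^sub>M BY) (\<lambda>y. (v, \<phi> v, y)))"
proof -
  have "J = p \<bind> (\<lambda>v. w (\<phi> v) \<bind> (\<lambda>y. return (S \<Otimes>\<^sub>M BX \<Otimes>\<^sub>M BY) (v, \<phi> v, y)))"
    unfolding joint_law_def encoded_input_def
    by (subst bind_distr[where K="S \<Otimes>\<^sub>M BX \<Otimes>\<^sub>M BY"])
       (auto intro!: measurable_prob_algebraD simp: source.not_empty)
  also have "\<dots> = p \<bind> (\<lambda>v. distr (w (\<phi> v)) (S \<Otimes>\<^sub>M BX \<Otimes>\<^sub>M BY) (\<lambda>y. (v, \<phi> v, y)))"
  proof (intro bind_cong refl)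
    fix v assume "v \<in> space p"
    then have v: "v \<in> space S" "\<phi> v \<in> space BX" by (auto simp: space_p encoder_space)
    have [measurable_cong]: "sets (w (\<phi> v)) = sets BY" by (rule sets_w[OF v(2)])
    show "w (\<phi> v) \<bind> (\<lambda>y. return (S \<Otimes>\<^sub>M BX \<Otimes>\<^sub>M BY) (v, \<phi> v, y)) =
        distr (w (\<phi> v)) (S \<Otimes>\<^sub>M BX \<Otimes>\<^sub>M BY) (\<lambda>y. (v, \<phi> v, y))"
      using v by (intro bind_return_distr' prob_space.not_empty prob_space_w) auto
  qed
  finally show ?thesis .
qed

text \<open>
  Under the joint law the codeword is a function of the source block, so integration reduces to
  the source law followed by the channel law at the codeword.  The marginals below are all
  evaluated through this formula.
\<close>

lemma nn_integral_J:
  assumes f[measurable]: "f \<in> borel_measurable (S \<Otimes>\<^sub>M BX \<Otimes>\<^sub>M BY)"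
  shows "(\<integral>\<^sup>+z. f z \<partial>J) = (\<integral>\<^sup>+v. \<integral>\<^sup>+y. f (v, \<phi> v, y) \<partial>w (\<phi> v) \<partial>p)"
proof -
  have "(\<integral>\<^sup>+z. f z \<partial>J) =
      (\<integral>\<^sup>+v. \<integral>\<^sup>+z. f z \<partial>distr (w (\<phi> v)) (S \<Otimes>\<^sub>M BX \<Otimes>\<^sub>M BY) (\<lambda>y. (v, \<phi> v, y)) \<partial>p)"
    unfolding J_eq_bind
    by (rule nn_integral_bind[where B="S \<Otimes>\<^sub>M BX \<Otimes>\<^sub>M BY"])
       (auto intro!: measurable_prob_algebraD measurable_distr_prob_space2[where M=BY])
  also have "\<dots> = (\<integral>\<^sup>+v. \<integral>\<^sup>+y. f (v, \<phi> v, y) \<partial>w (\<phi> v) \<partial>p)"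
  proof (intro nn_integral_cong)
    fix v assume "v \<in> space p"
    then have v: "v \<in> space S" "\<phi> v \<in> space BX" by (auto simp: space_p encoder_space)
    have [measurable_cong]: "sets (w (\<phi> v)) = sets BY" by (rule sets_w[OF v(2)])
    show "(\<integral>\<^sup>+z. f z \<partial>distr (w (\<phi> v)) (S \<Otimes>\<^sub>M BX \<Otimes>\<^sub>M BY) (\<lambda>y. (v, \<phi> v, y))) =
        (\<integral>\<^sup>+y. f (v, \<phi> v, y) \<partial>w (\<phi> v))"
      using v by (subst nn_integral_distr) auto
  qed
  finally show ?thesis .
qed

lemma input_law_eq_distr: "pX = distr p BX \<phi>"
proof (rule measure_eqI)
  show "sets pX = sets (distr p BX \<phi>)" by (simp add: input_law_def)
  fix E assume "E \<in> sets pX"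
  then have E[measurable]: "E \<in> sets BX" by (simp add: input_law_def)
  have "emeasure pX E = (\<integral>\<^sup>+x. indicator E x \<partial>pX)"
    by (simp add: input_law_def)
  also have "\<dots> = (\<integral>\<^sup>+z. indicator E (fst (snd z)) \<partial>J)"
    unfolding input_law_def by (subst nn_integral_distr) (auto simp: case_prod_beta)
  also have "\<dots> = (\<integral>\<^sup>+v. \<integral>\<^sup>+y. indicator E (\<phi> v) \<partial>w (\<phi> v) \<partial>p)"
    by (subst nn_integral_J) auto
  also have "\<dots> = (\<integral>\<^sup>+v. indicator E (\<phi> v) \<partial>p)"
    by (intro nn_integral_cong)
       (simp add: space_p encoder_space prob_space_w prob_space.emeasure_space_1)
  also have "\<dots> = emeasure (distr p BX \<phi>) E"
    using nn_integral_distr[of \<phi> p BX "indicator E"] by simp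
  finally show "emeasure pX E = emeasure (distr p BX \<phi>) E" .
qed

lemma nn_integral_pXY:
  assumes f[measurable]: "f \<in> borel_measurable (BX \<Otimes>\<^sub>M BY)"
  shows "(\<integral>\<^sup>+z. f z \<partial>pXY) = (\<integral>\<^sup>+v. \<integral>\<^sup>+y. f (\<phi> v, y) \<partial>w (\<phi> v) \<partial>p)"
proof -
  have "(\<lambda>(v, x, y). (x, y)) \<in> J \<rightarrow>\<^sub>M BX \<Otimes>\<^sub>M BY" by measurable
  then show ?thesis
    unfolding input_output_law_def
    by (subst nn_integral_distr) (simp_all add: nn_integral_J case_prod_beta)
qed

lemma nn_integral_pY:
  assumes f[measurable]: "f \<in> borel_measurable BY"
  shows "(\<integral>\<^sup>+y. f y \<partial>pY) = (\<integral>\<^sup>+v. \<integral>\<^sup>+y. f y \<partial>w (\<phi> v) \<partial>p)"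
  unfolding output_law_def
  by (subst nn_integral_distr) (auto simp: nn_integral_J case_prod_beta)

lemma emeasure_pY:
  assumes C[measurable]: "C \<in> sets BY"
  shows "emeasure pY C = (\<integral>\<^sup>+v. emeasure (w (\<phi> v)) C \<partial>p)"
proof -
  have "emeasure pY C = (\<integral>\<^sup>+y. indicator C y \<partial>pY)" by (simp add: output_law_def)
  also have "\<dots> = (\<integral>\<^sup>+v. emeasure (w (\<phi> v)) C \<partial>p)"
    by (subst nn_integral_pY) (auto intro!: nn_integral_cong simp: space_p sets_w encoder_space)
  finally show ?thesis .
qed

sublocale X: prob_space pX
  unfolding input_law_def by (rule joint.prob_space_distr) simp

sublocale Y: prob_space pY
  unfolding output_law_def by (rule joint.prob_space_distr) simp

lemma sets_pX[measurable_cong]: "sets pX = sets BX"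
  and sets_pY[measurable_cong]: "sets pY = sets BY"
  and sets_pXY[measurable_cong]: "sets pXY = sets (BX \<Otimes>\<^sub>M BY)"
  by (simp_all add: input_law_def output_law_def input_output_law_def)

lemma sets_pX_pY[measurable_cong]: "sets pX_pY = sets (BX \<Otimes>\<^sub>M BY)"
  unfolding product_law_def by (intro sets_pair_measure_cong sets_pX sets_pY)

lemma space_pY: "space pY = space BY"
  by (simp add: output_law_def)

lemma sigma_finite_pX_pY: "sigma_finite_measure pX_pY"
proof -
  interpret pair_prob_space pX pY ..
  show ?thesis unfolding product_law_def by unfold_locales
qed

lemma nn_integral_pX_pY:
  assumes f[measurable]: "f \<in> borel_measurable (BX \<Otimes>\<^sub>M BY)"
  shows "(\<integral>\<^sup>+z. f z \<partial>pX_pY) = (\<integral>\<^sup>+v. \<integral>\<^sup>+y. f (\<phi> v, y) \<partial>pY \<partial>p)"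
proof -
  have "(\<integral>\<^sup>+z. f z \<partial>pX_pY) = (\<integral>\<^sup>+x. \<integral>\<^sup>+y. f (x, y) \<partial>pY \<partial>pX)"
    unfolding product_law_def by (subst Y.nn_integral_fst) auto
  also have "\<dots> = (\<integral>\<^sup>+v. \<integral>\<^sup>+y. f (\<phi> v, y) \<partial>pY \<partial>p)"
    unfolding input_law_eq_distr by (subst nn_integral_distr) auto
  finally show ?thesis .
qed

section \<open>The information density on codewords\<close>

text \<open>
  The output law is the mixture of the channel laws \<open>w (\<phi> v)\<close> with weights \<open>p {v}\<close>, so it
  dominates each of them that has positive weight.  This is what makes the information density
  meaningful for the chosen input.
\<close>

lemma channel_null_if_output_null:
  assumes v: "v \<in> space S" "0 < emeasure p {v}" and C: "C \<in> sets BY" and "emeasure pY C = 0"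
  shows "emeasure (w (\<phi> v)) C = 0"
proof -
  have [measurable]: "C \<in> sets BY" by fact
  have "(\<integral>\<^sup>+v. emeasure (w (\<phi> v)) C \<partial>p) = 0"
    using assms emeasure_pY by simp
  then have "AE v in p. emeasure (w (\<phi> v)) C = 0"
    by (subst (asm) nn_integral_0_iff_AE) (auto simp: measurable_p)
  then show ?thesis using v by (simp add: AE_p)
qed

lemma absolutely_continuous_input_output: "absolutely_continuous pX_pY pXY"
  unfolding absolutely_continuous_def
proof
  fix N assume "N \<in> null_sets pX_pY"
  then have N[measurable]: "N \<in> sets (BX \<Otimes>\<^sub>M BY)" and N0: "emeasure pX_pY N = 0"
    by (auto simp: null_sets_def sets_pX_pY)
  have sec: "(\<integral>\<^sup>+y. indicator N (\<phi> v, y) \<partial>M) = emeasure M (Pair (\<phi> v) -` N)"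
    if "sets M = sets BY" for M v
  proof -
    have "Pair (\<phi> v) -` N \<in> sets M" using sets_Pair1[OF N] that by simp
    then have "emeasure M (Pair (\<phi> v) -` N) = (\<integral>\<^sup>+y. indicator (Pair (\<phi> v) -` N) y \<partial>M)" by simp
    also have "\<dots> = (\<integral>\<^sup>+y. indicator N (\<phi> v, y) \<partial>M)"
      by (intro nn_integral_cong) (simp split: split_indicator)
    finally show ?thesis by simp
  qed
  have "(\<integral>\<^sup>+v. emeasure pY (Pair (\<phi> v) -` N) \<partial>p) = (\<integral>\<^sup>+z. indicator N z \<partial>pX_pY)"
    by (subst nn_integral_pX_pY) (auto simp: sec sets_pY)
  also have "\<dots> = 0" using N0 by (simp add: sets_pX_pY)
  finally have "AE v in p. emeasure pY (Pair (\<phi> v) -` N) = 0"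
    by (subst (asm) nn_integral_0_iff_AE) (auto simp: measurable_p)
  then have null: "AE v in p. emeasure (w (\<phi> v)) (Pair (\<phi> v) -` N) = 0"
    unfolding AE_p using channel_null_if_output_null sets_Pair1[OF N] by blast
  have "emeasure pXY N = (\<integral>\<^sup>+z. indicator N z \<partial>pXY)" by (simp add: sets_pXY)
  also have "\<dots> = (\<integral>\<^sup>+v. emeasure (w (\<phi> v)) (Pair (\<phi> v) -` N) \<partial>p)"
    by (subst nn_integral_pXY)
       (auto intro!: nn_integral_cong simp: sec sets_w space_p encoder_space)
  also have "\<dots> = 0"
    using null by (subst nn_integral_cong_AE[where v="\<lambda>_. 0"]) auto
  finally show "N \<in> null_sets pXY" by (simp add: null_sets_def sets_pXY)
qed

lemma measurable_g[measurable]: "g \<in> borel_measurable (BX \<Otimes>\<^sub>M BY)"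
  using borel_measurable_RN_deriv[of pX_pY pXY]
  by (simp add: g_def measurable_cong_sets[OF sets_pX_pY refl])

lemma density_g: "density pX_pY g = pXY"
  unfolding g_def
  by (rule sigma_finite_measure.density_RN_deriv[OF sigma_finite_pX_pY
        absolutely_continuous_input_output])
     (simp add: sets_pX_pY sets_pXY)

text \<open>
  For a fixed event \<open>C\<close> both sides, as functions of the input, are densities with respect to the
  input law of the measure sending \<open>E\<close> to the probability that the input is in \<open>E\<close> and the
  output in \<open>C\<close>.  Hence they agree almost everywhere, and therefore at \<open>\<phi> v\<close> for every atom
  \<open>v\<close> of the source.
\<close>

lemma channel_law_density:
  assumes v: "v \<in> space S" "0 < emeasure p {v}" and C: "C \<in> sets BY"
  shows "emeasure (w (\<phi> v)) C = (\<integral>\<^sup>+y. g (\<phi> v, y) * indicator C y \<partial>pY)"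
proof -
  note C[measurable]
  have [measurable]: "(\<lambda>x. emeasure (w x) C) \<in> borel_measurable BX"
    by (rule measurable_compose[OF measurable_prob_algebraD[OF channel]
          measurable_emeasure_subprob_algebra[OF C]])
  have "AE x in pX. emeasure (w x) C = (\<integral>\<^sup>+y. g (x, y) * indicator C y \<partial>pY)"
  proof (rule X.density_unique)
    show "(\<lambda>x. emeasure (w x) C) \<in> borel_measurable pX"
      "(\<lambda>x. \<integral>\<^sup>+y. g (x, y) * indicator C y \<partial>pY) \<in> borel_measurable pX"
      by measurable
    show "density pX (\<lambda>x. emeasure (w x) C) =
        density pX (\<lambda>x. \<integral>\<^sup>+y. g (x, y) * indicator C y \<partial>pY)"
    proof (rule measure_eqI)
      fix E assume "E \<in> sets (density pX (\<lambda>x. emeasure (w x) C))"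
      then have E[measurable]: "E \<in> sets BX" by (simp add: sets_pX)
      let ?f = "\<lambda>z. indicator E (fst z) * indicator C (snd z) :: ennreal"
      have "emeasure (density pX (\<lambda>x. emeasure (w x) C)) E =
          (\<integral>\<^sup>+x. emeasure (w x) C * indicator E x \<partial>pX)"
        by (rule emeasure_density) auto
      also have "\<dots> = (\<integral>\<^sup>+v. emeasure (w (\<phi> v)) C * indicator E (\<phi> v) \<partial>p)"
        unfolding input_law_eq_distr by (subst nn_integral_distr) auto
      also have "\<dots> = (\<integral>\<^sup>+z. ?f z \<partial>pXY)"
      proof (subst nn_integral_pXY, measurable, intro nn_integral_cong)
        fix v assume "v \<in> space p"
        then have [measurable_cong]: "sets (w (\<phi> v)) = sets BY"
          by (simp add: space_p encoder_space sets_w)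
        have "(\<integral>\<^sup>+y. ?f (\<phi> v, y) \<partial>w (\<phi> v)) = indicator E (\<phi> v) * emeasure (w (\<phi> v)) C"
          by (simp add: nn_integral_cmult)
        then show "emeasure (w (\<phi> v)) C * indicator E (\<phi> v) = (\<integral>\<^sup>+y. ?f (\<phi> v, y) \<partial>w (\<phi> v))"
          by (simp add: mult.commute)
      qed
      also have "\<dots> = (\<integral>\<^sup>+z. g z * ?f z \<partial>pX_pY)"
        by (subst (1) density_g[symmetric]) (rule nn_integral_density, auto)
      also have "\<dots> = (\<integral>\<^sup>+v. \<integral>\<^sup>+y. g (\<phi> v, y) * (indicator E (\<phi> v) * indicator C y) \<partial>pY \<partial>p)"
        by (subst nn_integral_pX_pY) auto
      also have "\<dots> = (\<integral>\<^sup>+v. (\<integral>\<^sup>+y. g (\<phi> v, y) * indicator C y \<partial>pY) * indicator E (\<phi> v) \<partial>p)"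
      proof (intro nn_integral_cong)
        fix v assume "v \<in> space p"
        then have [measurable]: "\<phi> v \<in> space BX" by (simp add: space_p encoder_space)
        show "(\<integral>\<^sup>+y. g (\<phi> v, y) * (indicator E (\<phi> v) * indicator C y) \<partial>pY) =
            (\<integral>\<^sup>+y. g (\<phi> v, y) * indicator C y \<partial>pY) * indicator E (\<phi> v)"
          by (subst nn_integral_multc[symmetric]) (auto simp: mult_ac)
      qed
      also have "\<dots> = (\<integral>\<^sup>+x. (\<integral>\<^sup>+y. g (x, y) * indicator C y \<partial>pY) * indicator E x \<partial>distr p BX \<phi>)"
        by (subst nn_integral_distr) auto
      also have "\<dots> = emeasure (density pX (\<lambda>x. \<integral>\<^sup>+y. g (x, y) * indicator C y \<partial>pY)) E"
        unfolding input_law_eq_distr[symmetric] by (rule emeasure_density[symmetric]) auto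
      finally show "emeasure (density pX (\<lambda>x. emeasure (w x) C)) E =
          emeasure (density pX (\<lambda>x. \<integral>\<^sup>+y. g (x, y) * indicator C y \<partial>pY)) E" .
    qed simp
  qed
  then have "AE v in p. emeasure (w (\<phi> v)) C = (\<integral>\<^sup>+y. g (\<phi> v, y) * indicator C y \<partial>pY)"
    by (subst (asm) (1) input_law_eq_distr, subst (asm) AE_distr_iff) auto
  then show ?thesis
    using v by (simp add: AE_p)
qed


text \<open>
  A change of measure from the channel law to the output law, on an event where the density is
  at most \<open>exp t\<close>.  Where \<open>g\<close> is \<open>0\<close> or \<open>\<infinity>\<close> the real logarithm takes the value \<open>0\<close>, so
  \<open>ln (enn2real g) \<le> t\<close> does not bound \<open>g\<close> by itself at \<open>\<infinity>\<close>; but \<open>g (\<phi> v, _)\<close> has integral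
  \<open>1\<close> and so is finite almost everywhere.
\<close>

lemma low_information_bound:
  assumes v: "v \<in> space S" "0 < emeasure p {v}" and D[measurable]: "D \<in> sets BY"
  shows "emeasure (w (\<phi> v)) ({y \<in> space BY. ln (enn2real (g (\<phi> v, y))) \<le> t} \<inter> D)
    \<le> ennreal (exp t) * emeasure pY D"
proof -
  note [measurable] = encoder_space[OF v(1)]
  let ?C = "{y \<in> space BY. ln (enn2real (g (\<phi> v, y))) \<le> t} \<inter> D"
  have "(\<integral>\<^sup>+y. g (\<phi> v, y) * indicator (space BY) y \<partial>pY) = emeasure (w (\<phi> v)) (space BY)"
    using channel_law_density[OF v, of "space BY"] by simp
  also have "\<dots> = 1"
    using prob_space.emeasure_space_1[OF prob_space_w] space_w encoder_space[OF v(1)] by metis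
  finally have "AE y in pY. g (\<phi> v, y) * indicator (space BY) y \<noteq> \<infinity>"
    by (intro nn_integral_PInf_AE) auto
  then have finite: "AE y in pY. g (\<phi> v, y) \<noteq> \<infinity>"
    using AE_space by eventually_elim (auto simp: space_pY)
  have "emeasure (w (\<phi> v)) ?C = (\<integral>\<^sup>+y. g (\<phi> v, y) * indicator ?C y \<partial>pY)"
    by (rule channel_law_density[OF v]) measurable
  also have "\<dots> \<le> (\<integral>\<^sup>+y. ennreal (exp t) * indicator D y \<partial>pY)"
  proof (rule nn_integral_mono_AE)
    show "AE y in pY. g (\<phi> v, y) * indicator ?C y \<le> ennreal (exp t) * indicator D y"
      using finite
    proof eventually_elim
      case (elim y)
      then obtain r where r: "g (\<phi> v, y) = ennreal r" "0 \<le> r"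
        by (cases "g (\<phi> v, y)") auto
      \<comment> \<open>At \<open>r = 0\<close> the premise only says \<open>0 \<le> t\<close>, but the bound is trivial there.\<close>
      have "r \<le> exp t" if "ln r \<le> t"
      proof (cases "r = 0")
        case False
        then have "r = exp (ln r)" using r by simp
        also have "\<dots> \<le> exp t" using that by simp
        finally show ?thesis .
      qed simp
      then show ?case
        using r by (auto simp: indicator_def intro: ennreal_leI)
    qed
  qed
  also have "\<dots> = ennreal (exp t) * emeasure pY D"
    by (simp add: nn_integral_cmult sets_pY)
  finally show ?thesis .
qed

section \<open>Decoding regions and the error probability\<close>

abbreviation "D \<equiv> decoding_region MY n \<psi>"

lemma decoding_region_eq_vimage: "D v = \<psi> -` {v} \<inter> space BY"
  by (auto simp: decoding_region_def)

lemma decoding_region_sets[measurable]: "v \<in> space S \<Longrightarrow> D v \<in> sets BY"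
  unfolding decoding_region_eq_vimage
  by (rule measurable_sets[OF measurable_decoder singleton_in_sets])

text \<open>
  The decoding regions partition the output space: the summands are the point masses of the law
  of the decoded block.
\<close>

lemma sum_output_decoding_regions:
  "(\<integral>\<^sup>+v. emeasure pY (D v) \<partial>count_space (space S)) = 1"
proof -
  have \<psi>[measurable]: "\<psi> \<in> pY \<rightarrow>\<^sub>M S" by measurable
  interpret decoded: prob_space "distr pY S \<psi>"
    by (rule Y.prob_space_distr) measurable
  have "(\<integral>\<^sup>+v. emeasure pY (D v) \<partial>count_space (space S)) =
      (\<integral>\<^sup>+v. emeasure (distr pY S \<psi>) {v} \<partial>count_space (space S))"
    by (intro nn_integral_cong)
       (simp add: emeasure_distr singleton_in_sets decoding_region_eq_vimage space_pY)
  also have "\<dots> = emeasure (distr pY S \<psi>) (space S)"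
    by (rule emeasure_countable_singleton[symmetric])
       (auto simp: singleton_in_sets countable_blocks)
  also have "\<dots> = 1"
    using decoded.emeasure_space_1 by simp
  finally show ?thesis .
qed

abbreviation "error \<equiv> error_prob A MY n p w \<phi> \<psi>"

lemma error_nonneg: "0 \<le> error"
  unfolding error_prob_def by (intro infsum_nonneg) simp

text \<open>
  The terms of the sum defining the error probability are dominated by the point masses of the
  source law, so the sum converges and equals the integral over the counting measure.
\<close>

lemma ennreal_error:
  "ennreal error =
    (\<integral>\<^sup>+v. emeasure p {v} * emeasure (w (\<phi> v)) (space BY - D v) \<partial>count_space (space S))"
proof -
  let ?f = "\<lambda>v. measure p {v} * measure (w (\<phi> v)) (space BY - D v)"
  have "ennreal (?f v) = emeasure p {v} * emeasure (w (\<phi> v)) (space BY - D v)"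
    if "v \<in> space S" for v
  proof -
    interpret prob_space "w (\<phi> v)" using that by (intro prob_space_w encoder_space)
    show ?thesis by (simp add: ennreal_mult source.emeasure_eq_measure emeasure_eq_measure)
  qed
  then have eq: "(\<integral>\<^sup>+v. emeasure p {v} * emeasure (w (\<phi> v)) (space BY - D v) \<partial>count_space (space S))
      = (\<integral>\<^sup>+v. ennreal (?f v) \<partial>count_space (space S))"
    by (intro nn_integral_cong) simp
  have "(\<integral>\<^sup>+v. ennreal (?f v) \<partial>count_space (space S)) \<le> (\<integral>\<^sup>+v. emeasure p {v} \<partial>count_space (space S))"
  proof (rule nn_integral_mono)
    fix v assume "v \<in> space (count_space (space S))"
    then interpret prob_space "w (\<phi> v)" by (intro prob_space_w encoder_space) simp
    show "ennreal (?f v) \<le> emeasure p {v}"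
      by (simp add: source.emeasure_eq_measure mult_left_le)
  qed
  also have "\<dots> = emeasure p (space S)"
    by (rule emeasure_countable_singleton[symmetric])
       (auto simp: sets_p singleton_in_sets countable_blocks)
  also have "\<dots> < \<infinity>" by (simp add: source.emeasure_eq_measure)
  finally have "Infinite_Set_Sum.abs_summable_on ?f (space S)"
    unfolding Infinite_Set_Sum.abs_summable_on_def by (intro integrableI_nonneg) auto
  then show ?thesis
    unfolding eq error_prob_def by (simp add: nn_integral_conv_infsetsum infsetsum_infsum)
qed

lemma emeasure_low_information_event:
  assumes [measurable]: "t \<in> borel_measurable S"
  shows "emeasure J {(v, x, y) \<in> space J. information_density MX MY n J x y \<le> t v} =
    (\<integral>\<^sup>+v. emeasure p {v} * emeasure (w (\<phi> v))
      {y \<in> space BY. ln (enn2real (g (\<phi> v, y))) \<le> t v} \<partial>count_space (space S))"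
proof -
  let ?L = "{(v, x, y) \<in> space J. information_density MX MY n J x y \<le> t v}"
  let ?C = "\<lambda>v. {y \<in> space BY. ln (enn2real (g (\<phi> v, y))) \<le> t v}"
  have L: "?L = {z \<in> space J. ln (enn2real (g (snd z))) \<le> t (fst z)}"
    by (auto simp: information_density_def g_def)
  have [measurable]: "?L \<in> sets (S \<Otimes>\<^sub>M BX \<Otimes>\<^sub>M BY)"
    unfolding L sets_J[symmetric] by measurable
  have "emeasure J ?L = (\<integral>\<^sup>+z. indicator ?L z \<partial>J)"
    by (simp add: sets_J)
  also have "\<dots> = (\<integral>\<^sup>+v. \<integral>\<^sup>+y. indicator ?L (v, \<phi> v, y) \<partial>w (\<phi> v) \<partial>p)"
    by (rule nn_integral_J) measurable
  also have "\<dots> = (\<integral>\<^sup>+v. emeasure (w (\<phi> v)) (?C v) \<partial>p)"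
  proof (intro nn_integral_cong)
    fix v assume "v \<in> space p"
    then have v: "v \<in> space S" and [measurable]: "\<phi> v \<in> space BX"
      by (auto simp: space_p encoder_space)
    have [measurable_cong]: "sets (w (\<phi> v)) = sets BY" by (rule sets_w) fact
    have "(\<integral>\<^sup>+y. indicator ?L (v, \<phi> v, y) \<partial>w (\<phi> v)) = (\<integral>\<^sup>+y. indicator (?C v) y \<partial>w (\<phi> v))"
    proof (intro nn_integral_cong)
      fix y assume "y \<in> space (w (\<phi> v))"
      then have "y \<in> space BY" using space_w[OF \<open>\<phi> v \<in> space BX\<close>] by simp
      then show "indicator ?L (v, \<phi> v, y) = (indicator (?C v) y :: ennreal)"
        using v \<open>\<phi> v \<in> space BX\<close> sets_eq_imp_space_eq[OF sets_J]
        by (auto simp: L space_pair_measure information_density_def g_def split: split_indicator)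
    qed
    also have "\<dots> = emeasure (w (\<phi> v)) (?C v)"
      by (rule nn_integral_indicator) measurable
    finally show "(\<integral>\<^sup>+y. indicator ?L (v, \<phi> v, y) \<partial>w (\<phi> v)) = emeasure (w (\<phi> v)) (?C v)" .
  qed
  finally show ?thesis by (simp add: nn_integral_p)
qed

text \<open>
  Block by block, either the decoder errs, or the output is in \<open>D v\<close> and
  \<open>low_information_bound\<close> applies with \<open>t = ln (1 / p {v}) - c\<close>.  Since \<open>p {v} * exp t = exp (- c)\<close>,
  weighting by \<open>p {v}\<close> leaves a term whose sum over \<open>v\<close> is controlled by the
  partition into decoding regions.
\<close>

lemma low_information_prob_le_error:
  "\<P>((v, x, y) in J. information_density MX MY n J x y \<le> ln (1 / measure p {v}) - c)
    \<le> error + exp (- c)"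
proof -
  let ?t = "\<lambda>v. ln (1 / measure p {v}) - c"
  let ?C = "\<lambda>v. {y \<in> space BY. ln (enn2real (g (\<phi> v, y))) \<le> ?t v}"
  let ?L = "{(v, x, y) \<in> space J. information_density MX MY n J x y \<le> ?t v}"
  have pointwise: "emeasure p {v} * emeasure (w (\<phi> v)) (?C v) \<le>
      emeasure p {v} * emeasure (w (\<phi> v)) (space BY - D v) + ennreal (exp (- c)) * emeasure pY (D v)"
    if v: "v \<in> space S" for v
  proof (cases "emeasure p {v} = 0")
    case False
    then have pos: "0 < emeasure p {v}" by (simp add: zero_less_iff_neq_zero)
    then have mpos: "0 < measure p {v}" by (simp add: source.emeasure_eq_measure)
    note [measurable] = encoder_space[OF v] decoding_region_sets[OF v]
    have [measurable_cong]: "sets (w (\<phi> v)) = sets BY" by (rule sets_w) measurable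
    have "emeasure (w (\<phi> v)) (?C v) \<le> emeasure (w (\<phi> v)) ((space BY - D v) \<union> (?C v \<inter> D v))"
      by (rule emeasure_mono) (blast, measurable)
    also have "\<dots> \<le> emeasure (w (\<phi> v)) (space BY - D v) + emeasure (w (\<phi> v)) (?C v \<inter> D v)"
      by (rule emeasure_subadditive) measurable
    also have "\<dots> \<le> emeasure (w (\<phi> v)) (space BY - D v) + ennreal (exp (?t v)) * emeasure pY (D v)"
      by (intro add_left_mono low_information_bound v pos) measurable
    finally have "emeasure p {v} * emeasure (w (\<phi> v)) (?C v) \<le>
        emeasure p {v} * (emeasure (w (\<phi> v)) (space BY - D v) +
          ennreal (exp (?t v)) * emeasure pY (D v))"
      by (rule mult_left_mono) simp
    moreover have "emeasure p {v} * ennreal (exp (?t v)) = ennreal (exp (- c))"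
      using mpos by (simp add: source.emeasure_eq_measure ennreal_mult[symmetric] exp_diff exp_minus
          field_simps)
    ultimately show ?thesis
      by (simp add: distrib_left mult.assoc[symmetric])
  qed simp
  have "emeasure J ?L =
      (\<integral>\<^sup>+v. emeasure p {v} * emeasure (w (\<phi> v)) (?C v) \<partial>count_space (space S))"
    by (rule emeasure_low_information_event) (subst S_count_space, simp)
  also have "\<dots> \<le> (\<integral>\<^sup>+v. emeasure p {v} * emeasure (w (\<phi> v)) (space BY - D v) +
      ennreal (exp (- c)) * emeasure pY (D v) \<partial>count_space (space S))"
    by (intro nn_integral_mono pointwise) simp
  also have "\<dots> = ennreal error + ennreal (exp (- c))"
    by (simp add: nn_integral_add nn_integral_cmult ennreal_error sum_output_decoding_regions)
  also have "\<dots> = ennreal (error + exp (- c))"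
    by (simp add: ennreal_plus error_nonneg)
  finally show ?thesis
    using error_nonneg
    by (simp add: joint.emeasure_eq_measure add_nonneg_nonneg case_prod_beta' del: ennreal_plus)
qed

end

section \<open>Block length tending to infinity\<close>

theorem theorem4p2:
  fixes A :: "'v set" and MX :: "'x measure" and MY :: "'y measure"
    and P :: "nat \<Rightarrow> (nat \<Rightarrow> 'v) measure"
    and W :: "nat \<Rightarrow> (nat \<Rightarrow> 'x) \<Rightarrow> (nat \<Rightarrow> 'y) measure"
  assumes "countable A" and "infinite A"
    and "general_source A P"
    and "general_channel MX MY W"
    and "transmissible A MX MY P W"
  shows "\<exists>Q. channel_input A MX P Q \<and>
    (\<forall>n\<ge>1. absolutely_continuous
       (product_law MX MY n (joint_law A MX MY n (Q n) (W n)))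
       (input_output_law MX MY n (joint_law A MX MY n (Q n) (W n)))) \<and>
    (\<forall>\<gamma> :: nat \<Rightarrow> real.
       (\<forall>n\<ge>1. \<gamma> n > 0) \<longrightarrow> \<gamma> \<longlonglongrightarrow> 0 \<longrightarrow> filterlim (\<lambda>n. real n * \<gamma> n) at_top sequentially \<longrightarrow>
       (\<lambda>n. \<P>((v, x, y) in joint_law A MX MY n (Q n) (W n).
          1 / real n * information_density MX MY n (joint_law A MX MY n (Q n) (W n)) x y
            \<le> 1 / real n * ln (1 / measure (P n) {v}) - \<gamma> n)) \<longlonglongrightarrow> 0)"
proof -
  obtain \<phi> \<psi> where codes: "\<And>n. n \<ge> 1 \<Longrightarrow> joint_code A MX MY n (\<phi> n) (\<psi> n)"
    and err: "(\<lambda>n. error_prob A MY n (P n) (W n) (\<phi> n) (\<psi> n)) \<longlonglongrightarrow> 0"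
    using assms(5) unfolding transmissible_def by blast
  have code: "source_channel_code A MX MY n (P n) (W n) (\<phi> n) (\<psi> n)" if "n \<ge> 1" for n
    using assms(1,3,4) codes[OF that] that
    by unfold_locales (auto simp: general_source_def general_channel_def)
  define Q where "Q = (\<lambda>n. source_channel_code.encoded_input A MX n (P n) (\<phi> n))"
  note Q = fun_cong[OF Q_def]
  show ?thesis
  proof (intro exI[of _ Q] conjI allI impI)
    show "channel_input A MX P Q"
      unfolding channel_input_def Q
      using source_channel_code.encoded_input_in_prob_algebra[OF code]
        source_channel_code.source_marginal_encoded_input[OF code] by blast
  next
    fix n :: nat assume "n \<ge> 1"
    then show "absolutely_continuous
        (product_law MX MY n (joint_law A MX MY n (Q n) (W n)))
        (input_output_law MX MY n (joint_law A MX MY n (Q n) (W n)))"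
      unfolding Q by (rule source_channel_code.absolutely_continuous_input_output[OF code])
  next
    fix \<gamma> :: "nat \<Rightarrow> real"
    assume \<gamma>: "filterlim (\<lambda>n. real n * \<gamma> n) at_top sequentially"
    let ?J = "\<lambda>n. joint_law A MX MY n (Q n) (W n)"
    let ?pr = "\<lambda>n. \<P>((v, x, y) in ?J n.
      1 / real n * information_density MX MY n (?J n) x y
        \<le> 1 / real n * ln (1 / measure (P n) {v}) - \<gamma> n)"
    let ?err = "\<lambda>n. error_prob A MY n (P n) (W n) (\<phi> n) (\<psi> n)"
    have bound: "?pr n \<le> ?err n + exp (- (real n * \<gamma> n))" if n: "n \<ge> 1" for n
    proof -
      have "1 / real n * i \<le> 1 / real n * l - \<gamma> n \<longleftrightarrow> i \<le> l - real n * \<gamma> n" for i l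
        using n by (simp add: field_simps)
      then show ?thesis
        using source_channel_code.low_information_prob_le_error[OF code[OF n], of "real n * \<gamma> n"]
        by (simp only: Q)
    qed
    have "(\<lambda>n. exp (- (real n * \<gamma> n))) \<longlonglongrightarrow> 0"
      using \<gamma> by (intro filterlim_compose[OF exp_at_bot]) (simp add: filterlim_uminus_at_top)
    then have lim: "(\<lambda>n. ?err n + exp (- (real n * \<gamma> n))) \<longlonglongrightarrow> 0"
      using tendsto_add[OF err] by simp
    show "?pr \<longlonglongrightarrow> 0"
    proof (rule tendsto_sandwich[OF _ _ tendsto_const lim])
      show "eventually (\<lambda>n. 0 \<le> ?pr n) sequentially" by simp
      show "eventually (\<lambda>n. ?pr n \<le> ?err n + exp (- (real n * \<gamma> n))) sequentially"
        by (rule eventually_sequentiallyI[of 1]) (rule bound)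
    qed
  qed
qed

end
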